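(* Let $t\geq 2$ and $k$ be integers. (i) If $k=2t+r$ with $0\leq r\leq 2t-3$, then $A_{k,t}$ has an isolation set of size $2r+3=2k-4t+3$. (ii) If $k\geq 4t-3$, then $A_{k,t}$ has an isolation set of size $k$.
   Context: $[k]=\{1,\dots,k\}$ and $A_{k,t}$ is the Boolean matrix with rows and columns indexed by all $t$-subsets of $[k]$, with entry $1$ at $(x,y)$ iff $x\cap y\neq\emptyset$. An isolation set of a Boolean matrix $B$ is a set $F$ of entries of $B$ all equal to $1$, such that no two entries of $F$ lie in the same row or column, and no two entries of $F$ lie in a common $2\times 2$ all-ones submatrix of $B$ (i.e., for entries $(i,j),(i',j')\in F$ distinct, $B[i][j']=0$ or $B[i'][j]=0$). *)

theory Defs
  imports Main
begin

record ('r, 'c) bool_matrix =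
  rows :: "'r set"
  cols :: "'c set"
  entry :: "'r \<Rightarrow> 'c \<Rightarrow> bool"

text \<open>
  An entry is identified with its position \<open>(i, j)\<close>. Only the values of \<open>entry B\<close> on
  \<open>rows B \<times> cols B\<close> are meaningful, and only those are ever inspected below.
  For distinct one-entries in different rows and columns, lying in a common all-ones
  2-by-2 submatrix means that the two opposite corners are ones as well.
\<close>

definition isolation_set :: "('r, 'c) bool_matrix \<Rightarrow> ('r \<times> 'c) set \<Rightarrow> bool" where
  "isolation_set B F \<longleftrightarrow>
     F \<subseteq> rows B \<times> cols B \<and>
     (\<forall>(i, j) \<in> F. entry B i j) \<and>
     (\<forall>(i, j) \<in> F. \<forall>(i', j') \<in> F. (i, j) \<noteq> (i', j') \<longrightarrow>
        i \<noteq> i' \<and> j \<noteq> j' \<and> (\<not> entry B i j' \<or> \<not> entry B i' j))"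

definition t_subsets :: "nat \<Rightarrow> nat \<Rightarrow> nat set set" where
  "t_subsets k t = {x. x \<subseteq> {1..k} \<and> card x = t}"

definition intersection_matrix :: "nat \<Rightarrow> nat \<Rightarrow> (nat set, nat set) bool_matrix" where
  "intersection_matrix k t =
     \<lparr>rows = t_subsets k t, cols = t_subsets k t, entry = (\<lambda>x y. x \<inter> y \<noteq> {})\<rparr>"

end

theory Submission
  imports Defs
begin

text \<open>
  Let \<open>x\<^sub>i\<close> and \<open>y\<^sub>i\<close> be cyclic intervals modulo \<open>m\<close> of lengths \<open>a + 1\<close> and \<open>b + 1\<close>, where \<open>x\<^sub>i\<close> starts at the
  point where \<open>y\<^sub>i\<close> ends. Then \<open>x\<^sub>i\<close> meets \<open>y\<^sub>j\<close> only if \<open>j - i\<close> is congruent to a number in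
  \<open>{0..a + b}\<close>, so for \<open>m > 2 (a + b)\<close> two distinct indices cannot meet in both orders.
  The sets are filled up to size \<open>t\<close> with new points, one block common to all rows and another one
  common to all columns, which create no intersections. Part (i) takes \<open>m = 2 r + 3\<close> and
  \<open>a + b = r + 1\<close>, part (ii) takes \<open>m = k\<close> and \<open>a = b = t - 1\<close>.
\<close>

lemma isolation_set_image:
  assumes "\<And>i. i < m \<Longrightarrow> X i \<in> rows B \<and> Y i \<in> cols B \<and> entry B (X i) (Y i)"
    and iso: "\<And>i j. i < m \<Longrightarrow> j < m \<Longrightarrow> i \<noteq> j \<Longrightarrow> \<not> entry B (X i) (Y j) \<or> \<not> entry B (X j) (Y i)"
  shows "isolation_set B ((\<lambda>i. (X i, Y i)) ` {..<m})"
    and "card ((\<lambda>i. (X i, Y i)) ` {..<m}) = (m::nat)"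
proof -
  \<comment> \<open>If \<open>X i = X j\<close> or \<open>Y i = Y j\<close>, both opposite corners
    coincide with the one-entries at \<open>i\<close> and \<open>j\<close>, against
    \<open>iso\<close>.\<close>
  have distinct: "X i \<noteq> X j \<and> Y i \<noteq> Y j" if "i < m" "j < m" "i \<noteq> j" for i j
    using assms(1)[of i] assms(1)[of j] iso[of i j] that by metis
  show "isolation_set B ((\<lambda>i. (X i, Y i)) ` {..<m})"
    unfolding isolation_set_def
  proof (intro conjI)
    show "(\<lambda>i. (X i, Y i)) ` {..<m} \<subseteq> rows B \<times> cols B"
      using assms(1) by auto
    show "\<forall>(i, j)\<in>(\<lambda>i. (X i, Y i)) ` {..<m}. entry B i j"
      using assms(1) by auto
    show "\<forall>(i, j)\<in>(\<lambda>i. (X i, Y i)) ` {..<m}. \<forall>(i', j')\<in>(\<lambda>i. (X i, Y i)) ` {..<m}.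
        (i, j) \<noteq> (i', j') \<longrightarrow> i \<noteq> i' \<and> j \<noteq> j' \<and> (\<not> entry B i j' \<or> \<not> entry B i' j)"
      unfolding ball_simps prod.case using distinct iso by blast
  qed
  have "inj_on (\<lambda>i. (X i, Y i)) {..<m}"
    using distinct by (auto simp: inj_on_def)
  then show "card ((\<lambda>i. (X i, Y i)) ` {..<m}) = m"
    by (simp add: card_image)
qed

text \<open>\<open>Suc\<close> moves the residues modulo \<open>m\<close> into the ground set, which
  starts at 1. The start \<open>i\<close> may exceed \<open>m\<close>, so \<open>i + b\<close> can
  be passed unreduced.\<close>

definition cyclic_interval :: "nat \<Rightarrow> nat \<Rightarrow> nat \<Rightarrow> nat set" where
  "cyclic_interval m i n = (\<lambda>s. Suc ((i + s) mod m)) ` {..<n}"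

lemma cyclic_interval_subset:
  assumes "0 < m"
  shows "cyclic_interval m i n \<subseteq> {1..m}"
  using assms by (auto simp: cyclic_interval_def Suc_le_eq)

lemma add_mod_left_cancel:
  fixes m i s u :: nat
  assumes "(i + s) mod m = (i + u) mod m"
  shows "s mod m = u mod m"
proof -
  \<comment> \<open>Over the integers a congruence is divisibility of a difference, from which
    \<open>i\<close> cancels without truncation.\<close>
  have "(int i + int s) mod int m = (int i + int u) mod int m"
    using assms by (metis of_nat_add of_nat_mod)
  then have "int s mod int m = int u mod int m"
    by (simp add: mod_eq_dvd_iff)
  then show ?thesis
    by (metis of_nat_eq_iff of_nat_mod)
qed

lemma card_cyclic_interval:
  assumes "n \<le> m"
  shows "card (cyclic_interval m i n) = n"
proof -
  have "inj_on (\<lambda>s. Suc ((i + s) mod m)) {..<n}"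
  proof (rule inj_onI)
    fix s u
    assume "s \<in> {..<n}" "u \<in> {..<n}" "Suc ((i + s) mod m) = Suc ((i + u) mod m)"
    then show "s = u"
      using add_mod_left_cancel[of i s m u] assms by simp
  qed
  then show ?thesis
    by (simp add: cyclic_interval_def card_image)
qed

lemma cyclic_intervals_meetD:
  assumes "cyclic_interval m (i + b) (Suc a) \<inter> cyclic_interval m j (Suc b) \<noteq> {}"
  obtains v where "v \<le> a + b" "(i + v) mod m = j mod m"
proof -
  obtain s u where "s \<le> a" "u \<le> b" and eq: "(i + b + s) mod m = (j + u) mod m"
    using assms unfolding cyclic_interval_def by (auto simp: less_Suc_eq_le)
  \<comment> \<open>The subtraction is exact because \<open>u \<le> b\<close>.\<close>
  then have "(u + (i + (b + s - u))) mod m = (u + j) mod m"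
    by (simp add: ac_simps)
  then have "(i + (b + s - u)) mod m = j mod m"
    by (rule add_mod_left_cancel)
  moreover have "b + s - u \<le> a + b"
    using \<open>s \<le> a\<close> by simp
  ultimately show thesis
    using that by blast
qed

lemma cyclic_intervals_isolated:
  assumes "2 * (a + b) < m" "i < m" "j < m" "i \<noteq> j"
  shows "cyclic_interval m (i + b) (Suc a) \<inter> cyclic_interval m j (Suc b) = {} \<or>
         cyclic_interval m (j + b) (Suc a) \<inter> cyclic_interval m i (Suc b) = {}"
proof (rule ccontr)
  assume "\<not> ?thesis"
  then obtain v w where v: "v \<le> a + b" "(i + v) mod m = j mod m"
    and w: "w \<le> a + b" "(j + w) mod m = i mod m"
    by (metis cyclic_intervals_meetD)
  \<comment> \<open>Going from \<open>i\<close> to \<open>j\<close> and back makes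
    \<open>v + w\<close> a multiple of \<open>m\<close>; being at most
    \<open>2 * (a + b) < m\<close>, it is 0, which forces \<open>i = j\<close>.\<close>
  have "(i + (v + w)) mod m = (i + 0) mod m"
    using v(2) w(2) by (metis add.assoc add_0_right mod_add_left_eq)
  then have "(v + w) mod m = 0 mod m"
    by (rule add_mod_left_cancel)
  then have "v = 0"
    using v(1) w(1) assms(1) by simp
  then show False
    using v(2) assms by simp
qed

text \<open>Here \<open>p\<close> and \<open>q\<close> count the filling points of each row and each
  column; they are taken from above \<open>m\<close>, hence the bound on
  \<open>m + p + q\<close>.\<close>

lemma intersection_matrix_isolation_set:
  assumes m: "2 * (a + b) < m" and k: "m + p + q \<le> k"
    and t: "Suc a + p = t" "Suc b + q = t"
  shows "\<exists>F. isolation_set (intersection_matrix k t) F \<and> card F = m"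
proof -
  define X where "X i = cyclic_interval m (i + b) (Suc a) \<union> {m<..m + p}" for i
  define Y where "Y i = cyclic_interval m i (Suc b) \<union> {m + p<..m + p + q}" for i
  have sub: "cyclic_interval m i n \<subseteq> {1..m}" for i n
    using m by (intro cyclic_interval_subset) simp
  have fin: "finite (cyclic_interval m i n)" for i n
    by (simp add: cyclic_interval_def)
  have X: "X i \<in> t_subsets k t" for i
  proof -
    have "cyclic_interval m (i + b) (Suc a) \<inter> {m<..m + p} = {}"
      using sub by fastforce
    then have "card (X i) = t"
      using t m by (simp add: X_def card_Un_disjoint fin card_cyclic_interval)
    moreover have "X i \<subseteq> {1..k}"
      using sub[of "i + b" "Suc a"] k by (fastforce simp: X_def)
    ultimately show ?thesis
      by (simp add: t_subsets_def)
  qed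
  have Y: "Y i \<in> t_subsets k t" for i
  proof -
    have "cyclic_interval m i (Suc b) \<inter> {m + p<..m + p + q} = {}"
      using sub by fastforce
    then have "card (Y i) = t"
      using t m by (simp add: Y_def card_Un_disjoint fin card_cyclic_interval)
    moreover have "Y i \<subseteq> {1..k}"
      using sub[of i "Suc b"] k by (fastforce simp: Y_def)
    ultimately show ?thesis
      by (simp add: t_subsets_def)
  qed
  have XY: "X i \<inter> Y j = cyclic_interval m (i + b) (Suc a) \<inter> cyclic_interval m j (Suc b)" for i j
    using sub[of "i + b" "Suc a"] sub[of j "Suc b"] by (fastforce simp: X_def Y_def)
  have "X i \<inter> Y i \<noteq> {}" for i
  proof -
    \<comment> \<open>The witness is the first point of the row interval (offset 0) and the last of
      the column interval (offset \<open>b\<close>).\<close>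
    have "Suc ((i + b) mod m) \<in> cyclic_interval m (i + b) (Suc a) \<inter> cyclic_interval m i (Suc b)"
      by (force simp: cyclic_interval_def)
    then show ?thesis
      unfolding XY by blast
  qed
  moreover have "X i \<inter> Y j = {} \<or> X j \<inter> Y i = {}" if "i < m" "j < m" "i \<noteq> j" for i j
    unfolding XY using m that by (rule cyclic_intervals_isolated)
  ultimately show ?thesis
    using X Y isolation_set_image[of m X "intersection_matrix k t" Y]
    by (auto simp: intersection_matrix_def)
qed

theorem theorem3:
  fixes t k :: nat
  assumes "t \<ge> 2"
  shows "(\<forall>r. k = 2 * t + r \<and> r \<le> 2 * t - 3 \<longrightarrow>
            2 * r + 3 = 2 * k - 4 * t + 3 \<and>
            (\<exists>F. isolation_set (intersection_matrix k t) F \<and> card F = 2 * r + 3)) \<and>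
         (k \<ge> 4 * t - 3 \<longrightarrow>
            (\<exists>F. isolation_set (intersection_matrix k t) F \<and> card F = k))"
proof (intro conjI allI impI)
  fix r
  assume r: "k = 2 * t + r \<and> r \<le> 2 * t - 3"
  then show "2 * r + 3 = 2 * k - 4 * t + 3"
    by simp
  \<comment> \<open>A greedy split of \<open>r + 1 \<le> 2 * (t - 1)\<close> into two parts of at
    most \<open>t - 1\<close>. The filling then takes \<open>2 * t - r - 3\<close> points, so
    together with the \<open>2 * r + 3\<close> cyclic ones exactly \<open>k\<close> are
    used.\<close>
  define a where "a = min (t - 1) (r + 1)"
  define b where "b = r + 1 - a"
  have "a + b = r + 1" "a \<le> t - 1" "b \<le> t - 1"
    using r assms by (auto simp: a_def b_def)
  then show "\<exists>F. isolation_set (intersection_matrix k t) F \<and> card F = 2 * r + 3"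
    using r assms
    by (intro intersection_matrix_isolation_set[of a b _ "t - 1 - a" "t - 1 - b"]) auto
next
  assume "k \<ge> 4 * t - 3"
  then show "\<exists>F. isolation_set (intersection_matrix k t) F \<and> card F = k"
    using assms
    by (intro intersection_matrix_isolation_set[of "t - 1" "t - 1" _ 0 0]) auto
qed

end
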